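(* Let $0\le a<b$. For every $\bar\Pi\in\mathcal P_{NCN}(\mathbb R,[a,b])$ whose support is $\operatorname{supp}\bar\Pi=\mathbb R\times[\bar a,\bar b]$ for some $a\le \bar a<\bar b\le b$, there exists $\Pi\in\mathcal P_{NCN}(\mathbb R,[a,b])$ with $\Pi\neq\bar\Pi$ and $F(\cdot\,;\Pi)=F(\cdot\,;\bar\Pi)$. In particular, $\Pi$ is not identifiable from $F(\cdot\,;\Pi)$ within $\mathcal P_{NCN}(\mathbb R,[a,b])$.
   Context: Model: $(X,S)\sim\Pi$, where $\Pi$ is a probability distribution on $\mathbb R\times[0,\infty)$; $\varepsilon\sim N(0,1)$ is independent of $(X,S)$; the observed variable is $Y=X+S\varepsilon$. Its distribution function is $F(y;\Pi)=\Pi\circ\Phi(y):=\int\Phi\big(\frac{y-x}{s}\big)\,d\Pi(x,s)$, where $\Phi$ is the standard normal cdf (with $s=0$ meaning a point mass at $x$). For $\mathcal I\subseteq\mathbb R$ and $\mathcal S\subseteq[0,\infty)$, $\mathcal P(\mathcal I,\mathcal S)$ is the set of probability distributions $\Pi$ with $\operatorname{supp}\Pi\subseteq\mathcal I\times\mathcal S$. A distribution $P$ on $\mathbb R$ "has no normal component" ($P\in\mathrm{NNorm}$) if it cannot be written as the convolution of some probability distribution with a normal distribution $N(0,\sigma^2)$ with $\sigma^2>0$. $\mathcal P_{NCN}(\mathcal I,\mathcal S)=\{\Pi\in\mathcal P(\mathcal I,\mathcal S):\ \text{for all } s\in\mathcal S,\ \text{the conditional law } \Pi(X\mid S=s)\in\mathrm{NNorm}\}$.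 *)

theory Defs
  imports "HOL-Probability.Probability"
begin

definition prob_distrs :: "'a::topological_space measure set" where
  "prob_distrs = {M. prob_space M \<and> sets M = sets borel}"

definition msupport :: "'a::topological_space measure \<Rightarrow> 'a set" where
  "msupport M = {z. \<forall>U. open U \<longrightarrow> z \<in> U \<longrightarrow> emeasure M U \<noteq> 0}"

definition Phi :: "real \<Rightarrow> real" where
  "Phi t = measure (density lborel std_normal_density) {..t}"

(* Phi((y-x)/s), with s = 0 meaning a point mass at x *)
definition Phi_kernel :: "real \<Rightarrow> real \<Rightarrow> real \<Rightarrow> real" where
  "Phi_kernel y x s = (if s = 0 then (if x \<le> y then 1 else 0) else Phi ((y - x) / s))"

definition Fmix :: "real \<Rightarrow> (real \<times> real) measure \<Rightarrow> real" where
  "Fmix y P = (\<integral>z. Phi_kernel y (fst z) (snd z) \<partial>P)"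

definition normal_measure :: "real \<Rightarrow> real measure" where
  "normal_measure \<sigma> = density lborel (normal_density 0 \<sigma>)"

definition NNorm :: "real measure set" where
  "NNorm = {P. \<not> (\<exists>Q \<sigma>. \<sigma> > 0 \<and> Q \<in> prob_distrs \<and> P = convolution Q (normal_measure \<sigma>))}"

definition Pset :: "real set \<Rightarrow> real set \<Rightarrow> (real \<times> real) measure set" where
  "Pset I S = {M \<in> prob_distrs. msupport M \<subseteq> I \<times> S}"

definition cond_law_X_given_S :: "(real \<times> real) measure \<Rightarrow> (real \<Rightarrow> real measure) \<Rightarrow> bool" where
  "cond_law_X_given_S M K \<longleftrightarrow>
     K \<in> borel \<rightarrow>\<^sub>M subprob_algebra borel \<and>
     (\<forall>s. K s \<in> prob_distrs) \<and>
     (\<forall>A \<in> sets borel. emeasure M A =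
        (\<integral>\<^sup>+ s. emeasure (K s) {x. (x, s) \<in> A} \<partial>(distr M borel snd)))"

definition P_NCN :: "real set \<Rightarrow> real set \<Rightarrow> (real \<times> real) measure set" where
  "P_NCN I S = {M \<in> Pset I S. \<exists>K. cond_law_X_given_S M K \<and> (\<forall>s \<in> S. K s \<in> NNorm)}"

end

theory Submission
  imports Defs "HOL-Real_Asymp.Real_Asymp"
begin

text \<open>
  Under \<open>Pbar\<close>, the law of \<open>Y\<close> equals \<open>M \<star> N(0, a\<^sup>2)\<close>, where \<open>M\<close> is the law of
  \<open>X + sqrt (S\<^sup>2 - a\<^sup>2) \<epsilon>\<close>. If \<open>M\<close> has no normal component, then \<open>X \<sim> M\<close>, \<open>S = a\<close> is a
  second representation. Otherwise \<open>M = Q \<star> N(0, \<sigma>\<^sup>2)\<close> has a positive continuous density \<open>g\<close>.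
  For \<open>0 < v < \<sigma>\<close> with \<open>t\<^sup>2 = a\<^sup>2 + v\<^sup>2 \<le> b\<^sup>2\<close>, the quotient of \<open>g\<close> by the density \<open>h\<close> of
  \<open>N(0, v\<^sup>2)\<close> tends to infinity at both ends, so it attains a minimum \<open>c < 1\<close>. The law \<open>K\<close> with
  density \<open>(g - c h) / (1 - c)\<close> has no normal component, because its density is continuous and
  vanishes somewhere. Since \<open>h\<close> smoothed by \<open>N(0, a\<^sup>2)\<close> is \<open>N(0, t\<^sup>2)\<close>, taking \<open>X \<sim> K\<close>, \<open>S = a\<close> with
  probability \<open>1 - c\<close> and \<open>X = 0\<close>, \<open>S = t\<close> with probability \<open>c\<close> reproduces the law of \<open>Y\<close>.
  In both cases \<open>S\<close> takes at most two values, whereas \<open>Pbar\<close> charges every open strip inside its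
  support.
\<close>

section \<open>Normal laws and the kernel \<open>Phi_kernel\<close>\<close>

lemma prob_space_normal_measure: "0 < \<sigma> \<Longrightarrow> prob_space (normal_measure \<sigma>)"
  by (simp add: normal_measure_def prob_space_normal_density)

lemma sets_normal_measure [simp, measurable_cong]: "sets (normal_measure \<sigma>) = sets borel"
  by (simp add: normal_measure_def)

lemma space_normal_measure [simp]: "space (normal_measure \<sigma>) = UNIV"
  by (simp add: normal_measure_def)

lemma distr_scale_std_normal:
  assumes "0 < t"
  shows "distr (normal_measure 1) borel (\<lambda>e. t * e) = normal_measure t"
proof -
  interpret prob_space "normal_measure 1" by (rule prob_space_normal_measure) simp
  have "distributed (normal_measure 1) lborel (\<lambda>x. x) (normal_density 0 1)"
    by (auto simp: distributed_def normal_measure_def cong: distr_cong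
        intro!: measure_eqI simp: emeasure_distr)
  from normal_density_affine[OF this, of t 0] assms
  have "distributed (normal_measure 1) lborel (\<lambda>x. t * x) (normal_density 0 t)"
    by simp
  then show ?thesis
    by (auto simp: distributed_def normal_measure_def cong: distr_cong)
qed

lemma Phi_kernel_eq_measure:
  assumes "0 < s"
  shows "Phi_kernel y x s = measure (normal_measure s) {..y - x}"
proof -
  have "measure (normal_measure s) {..y - x} = measure (normal_measure 1) ((\<lambda>e. s * e) -` {..y - x})"
    by (subst distr_scale_std_normal[OF assms, symmetric], subst measure_distr) auto
  also have "(\<lambda>e. s * e) -` {..y - x} = {..(y - x) / s}"
    using assms by (auto simp: field_simps)
  finally show ?thesis
    using assms by (simp add: Phi_kernel_def Phi_def normal_measure_def)
qed

lemma Phi_kernel_bounds: "0 \<le> s \<Longrightarrow> 0 \<le> Phi_kernel y x s \<and> Phi_kernel y x s \<le> 1"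
  using Phi_kernel_eq_measure[of s y x] prob_space.prob_le_1[OF prob_space_normal_measure, of s]
  by (cases "s = 0") (auto simp: Phi_kernel_def[of _ _ 0])

lemma Phi_bounds: "0 \<le> Phi t" "Phi t \<le> 1"
  using prob_space.prob_le_1[OF prob_space_normal_measure, of 1]
  by (auto simp: Phi_def normal_measure_def)

text \<open>Allowing negative \<open>s\<close> as well makes the kernel integrable against any
  probability law on the plane, with no restriction to nonnegative scales.\<close>

lemma abs_Phi_kernel_le: "\<bar>Phi_kernel y x s\<bar> \<le> 1"
  by (auto simp: Phi_kernel_def Phi_bounds)

lemma Phi_borel_measurable [measurable]: "Phi \<in> borel_measurable borel"
proof (rule borel_measurable_mono)
  interpret prob_space "density lborel std_normal_density"
    using prob_space_normal_measure[of 1] by (simp add: normal_measure_def)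
  show "mono Phi"
    unfolding Phi_def by (intro monoI finite_measure_mono) auto
qed

lemma Phi_kernel_borel_measurable [measurable (raw)]:
  assumes [measurable]: "f \<in> borel_measurable M" "g \<in> borel_measurable M"
  shows "(\<lambda>z. Phi_kernel y (f z) (g z)) \<in> borel_measurable M"
  unfolding Phi_kernel_def by measurable

lemma convolution_normal_measure:
  assumes "0 < s" "0 < t"
  shows "normal_measure t \<star> normal_measure s = normal_measure (sqrt (t\<^sup>2 + s\<^sup>2))"
  using assms prob_space_normal_density[of s 0] prob_space_normal_density[of t 0]
    conv_normal_density_zero_mean[of t s]
  unfolding normal_measure_def
  by (subst convolution_density) (auto simp: prob_space.finite_measure ennreal_mult'[symmetric])

text \<open>Variances add: normal noise \<open>t\<close> in the location and noise \<open>s\<close>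
  in the observation act as one noise. For \<open>s = 0\<close> the kernel is an indicator and its
  integral is already the cdf of \<open>normal_measure t\<close>; for \<open>s > 0\<close> the
  integral is the cdf of a convolution of two normal laws.\<close>

lemma integral_Phi_kernel_normal:
  assumes "0 \<le> s" "0 < t"
  shows "(\<integral>z. Phi_kernel y (x + z) s \<partial>normal_measure t) = Phi_kernel y x (sqrt (s\<^sup>2 + t\<^sup>2))"
proof -
  interpret T: prob_space "normal_measure t" using assms by (rule_tac prob_space_normal_measure)
  have pos: "0 < sqrt (s\<^sup>2 + t\<^sup>2)"
    using assms by (simp add: add_nonneg_pos)
  show ?thesis
  proof (cases "s = 0")
    case True
    have "(\<integral>z. Phi_kernel y (x + z) s \<partial>normal_measure t) = (\<integral>z. indicator {..y - x} z \<partial>normal_measure t)"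
      using True by (intro Bochner_Integration.integral_cong) (auto simp: Phi_kernel_def indicator_def)
    then show ?thesis
      using True assms by (simp add: Phi_kernel_eq_measure)
  next
    case False
    then have s: "0 < s" using assms by simp
    interpret S: prob_space "normal_measure s" using s by (rule prob_space_normal_measure)
    have "emeasure (normal_measure t \<star> normal_measure s) {..y - x}
        = (\<integral>\<^sup>+z. emeasure (normal_measure s) {..y - (x + z)} \<partial>normal_measure t)"
      using T.finite_measure_axioms S.finite_measure_axioms
      by (subst convolution_emeasure)
        (auto intro!: nn_integral_cong arg_cong[where f = "emeasure (normal_measure s)"])
    also have "\<dots> = (\<integral>\<^sup>+z. ennreal (Phi_kernel y (x + z) s) \<partial>normal_measure t)"
      by (intro nn_integral_cong) (simp add: Phi_kernel_eq_measure[OF s] S.emeasure_eq_measure)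
    also have "\<dots> = ennreal (\<integral>z. Phi_kernel y (x + z) s \<partial>normal_measure t)"
      using Phi_kernel_bounds[OF assms(1)]
      by (intro nn_integral_eq_integral T.integrable_const_bound[where B = 1]) auto
    finally show ?thesis
      using Phi_kernel_eq_measure[OF pos, of y x] s assms Phi_kernel_bounds[OF assms(1)]
      by (simp add: convolution_normal_measure add.commute measure_def)
  qed
qed

text \<open>Scaling a standard normal variable admits \<open>t = 0\<close>, which occurs when the
  scale equals \<open>a\<close>. There \<open>normal_measure 0\<close> would not do: its density is
  zero everywhere, so it is not a point mass.\<close>

lemma integral_Phi_kernel_std_normal:
  assumes "0 \<le> s" "0 \<le> t"
  shows "(\<integral>e. Phi_kernel y (x + t * e) s \<partial>normal_measure 1) = Phi_kernel y x (sqrt (s\<^sup>2 + t\<^sup>2))"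
proof (cases "t = 0")
  case True
  interpret prob_space "normal_measure 1" by (rule prob_space_normal_measure) simp
  show ?thesis using True assms prob_space by simp
next
  case False
  then have t: "0 < t" using assms by simp
  show ?thesis
    unfolding integral_Phi_kernel_normal[OF assms(1) t, symmetric]
      distr_scale_std_normal[OF t, symmetric]
    by (subst integral_distr) auto
qed

section \<open>Supports and probability laws\<close>

lemma emeasure_open_disjoint_msupport:
  fixes M :: "'a::second_countable_topology measure"
  assumes [measurable_cong]: "sets M = sets borel" and "open U" "U \<inter> msupport M = {}"
  shows "emeasure M U = 0"
proof -
  define F where "F = {V. open V \<and> emeasure M V = 0}"
  have "\<And>V. V \<in> F \<Longrightarrow> open V" by (simp add: F_def)
  \<comment> \<open>The union of all open null sets may be uncountable; second countability replaces
    it by a countable union, which is again null.\<close>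
  from Lindelof[OF this] obtain F' where F': "F' \<subseteq> F" "countable F'" "\<Union>F' = \<Union>F"
    by metis
  have "(\<Union>V\<in>F'. V) \<in> null_sets M"
    using F' by (intro null_sets_UN') (auto simp: F_def null_sets_def assms(1))
  moreover have "U \<subseteq> (\<Union>V\<in>F'. V)"
    using assms(3) F'(3) by (auto simp: F_def msupport_def)
  ultimately show ?thesis
    by (rule_tac emeasure_eq_0[of "\<Union>V\<in>F'. V"]) auto
qed

lemma prob_distrsD:
  assumes "M \<in> prob_distrs"
  shows "prob_space M" "sets M = sets borel" "space M = UNIV"
  using assms by (auto simp: prob_distrs_def dest: sets_eq_imp_space_eq)

section \<open>The density of a law convolved with a normal law\<close>

lemma prob_distrs_real_distribution:
  "Q \<in> prob_distrs \<Longrightarrow> real_distribution Q"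
  by (auto simp: prob_distrs_def real_distribution_def real_distribution_axioms_def)

text \<open>This is the density of \<open>convolution Q (normal_measure \<sigma>)\<close>. Fixing a
  version at every point, and not only almost everywhere, lets continuity and positivity be used
  pointwise.\<close>

definition gauss_smooth :: "real measure \<Rightarrow> real \<Rightarrow> real \<Rightarrow> real" where
  "gauss_smooth Q \<sigma> x = (\<integral>z. normal_density 0 \<sigma> (x - z) \<partial>Q)"

lemma normal_density_antimono:
  assumes "0 < \<sigma>" "\<bar>x\<bar> \<le> \<bar>y\<bar>"
  shows "normal_density 0 \<sigma> y \<le> normal_density 0 \<sigma> x"
proof -
  have "x\<^sup>2 \<le> y\<^sup>2" using assms(2) by (simp add: abs_le_square_iff)
  then show ?thesis using assms by (auto simp: normal_density_def intro!: divide_right_mono)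
qed

lemma normal_density_le:
  assumes "0 < \<sigma>"
  shows "normal_density 0 \<sigma> x \<le> normal_density 0 \<sigma> 0"
  using assms by (rule normal_density_antimono) simp

context
  fixes Q :: "real measure" and \<sigma> :: real
  assumes Q: "Q \<in> prob_distrs" and \<sigma>: "0 < \<sigma>"
begin

interpretation real_distribution Q by (rule prob_distrs_real_distribution[OF Q])

lemma integrable_normal_density_shift: "integrable Q (\<lambda>z. normal_density 0 \<sigma> (x - z))"
  by (rule integrable_const_bound[where B = "normal_density 0 \<sigma> 0"])
    (auto simp: normal_density_le[OF \<sigma>])

text \<open>Dominated convergence, with the peak of the normal density as a constant bound.\<close>

lemma continuous_gauss_smooth: "continuous_on UNIV (gauss_smooth Q \<sigma>)"
proof -
  have "continuous (at x) (gauss_smooth Q \<sigma>)" for x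
    unfolding gauss_smooth_def continuous_at_sequentially comp_def
  proof safe
    fix u assume u: "u \<longlonglongrightarrow> x"
    show "(\<lambda>n. \<integral>z. normal_density 0 \<sigma> (u n - z) \<partial>Q) \<longlonglongrightarrow> (\<integral>z. normal_density 0 \<sigma> (x - z) \<partial>Q)"
    proof (rule integral_dominated_convergence[where w = "\<lambda>_. normal_density 0 \<sigma> 0"])
      show "AE z in Q. (\<lambda>n. normal_density 0 \<sigma> (u n - z)) \<longlonglongrightarrow> normal_density 0 \<sigma> (x - z)"
        using \<sigma> unfolding normal_density_def by (intro AE_I2 tendsto_intros u) auto
    qed (auto simp: normal_density_le[OF \<sigma>])
  qed
  then show ?thesis by (simp add: continuous_at_imp_continuous_on)
qed

text \<open>Some interval \<open>[-n, n]\<close> carries more than half of \<open>Q\<close>, and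
  every \<open>z\<close> in it is at distance at most \<open>\<bar>x\<bar> + n\<close> from
  \<open>x\<close>. Since \<open>m = n\<close> does not depend on \<open>x\<close>, the bound gives
  both positivity and control of the tails.\<close>

lemma gauss_smooth_lower_bound:
  obtains m where "\<And>x. normal_density 0 \<sigma> (\<bar>x\<bar> + m) / 2 \<le> gauss_smooth Q \<sigma> x"
proof -
  have "(\<lambda>n. prob {- real n..real n}) \<longlonglongrightarrow> prob (\<Union>n. {- real n..real n})"
    by (rule finite_Lim_measure_incseq) (auto simp: incseq_def events_eq_borel)
  also have "(\<Union>n. {- real n..real n}) = space Q"
  proof -
    have "\<exists>n. x \<in> {- real n..real n}" for x
      using real_arch_simple[of "\<bar>x\<bar>"] by (auto simp: abs_le_iff minus_le_iff)
    then show ?thesis using space_eq_univ by auto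
  qed
  finally have "eventually (\<lambda>n. 1/2 < prob {- real n..real n}) sequentially"
    by (rule order_tendstoD) (simp add: prob_space del: space_eq_univ)
  then obtain n where n: "1/2 < prob {- real n..real n}"
    by (auto simp: eventually_sequentially)
  show thesis
  proof (rule that[of "real n"])
    fix x
    let ?d = "normal_density 0 \<sigma> (\<bar>x\<bar> + real n)"
    have "integrable Q (\<lambda>z. ?d * indicator {- real n..real n} z)"
      by (rule integrable_const_bound[where B = ?d]) (auto simp: indicator_def)
    moreover have "?d * indicator {- real n..real n} z \<le> normal_density 0 \<sigma> (x - z)" for z
      by (auto simp: indicator_def intro!: normal_density_antimono[OF \<sigma>])
    ultimately have le: "(\<integral>z. ?d * indicator {- real n..real n} z \<partial>Q) \<le> gauss_smooth Q \<sigma> x"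
      unfolding gauss_smooth_def by (intro integral_mono integrable_normal_density_shift)
    have "?d * (1/2) \<le> ?d * prob {- real n..real n}"
      using n by (intro mult_left_mono) auto
    also have "\<dots> = (\<integral>z. ?d * indicator {- real n..real n} z \<partial>Q)"
      by (simp add: events_eq_borel space_eq_univ)
    also have "\<dots> \<le> gauss_smooth Q \<sigma> x"
      by (rule le)
    finally show "?d / 2 \<le> gauss_smooth Q \<sigma> x" by simp
  qed
qed

lemma gauss_smooth_pos: "0 < gauss_smooth Q \<sigma> x"
proof -
  obtain m where "\<And>x. normal_density 0 \<sigma> (\<bar>x\<bar> + m) / 2 \<le> gauss_smooth Q \<sigma> x"
    using gauss_smooth_lower_bound by metis
  from this[of x] show ?thesis
    using normal_density_pos[OF \<sigma>, of 0 "\<bar>x\<bar> + m"] by simp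
qed

lemma gauss_smooth_measurable [measurable]: "gauss_smooth Q \<sigma> \<in> borel_measurable borel"
  by (rule borel_measurable_continuous_onI[OF continuous_gauss_smooth])

text \<open>Translating the Lebesgue integral by \<open>z\<close> moves the shift into the normal
  density; Fubini then puts the integral over \<open>Q\<close> inside.\<close>

lemma convolution_normal_measure_eq_density:
  "convolution Q (normal_measure \<sigma>) = density lborel (\<lambda>x. ennreal (gauss_smooth Q \<sigma> x))"
proof (rule measure_eqI)
  interpret N: prob_space "normal_measure \<sigma>" by (rule prob_space_normal_measure[OF \<sigma>])
  interpret QL: pair_sigma_finite Q lborel ..
  fix A assume "A \<in> sets (convolution Q (normal_measure \<sigma>))"
  then have A [measurable]: "A \<in> sets borel" by simp
  have "emeasure (convolution Q (normal_measure \<sigma>)) A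
      = (\<integral>\<^sup>+z. \<integral>\<^sup>+y. indicator A (z + y) \<partial>normal_measure \<sigma> \<partial>Q)"
    by (intro convolution_emeasure') (auto simp: events_eq_borel finite_measure_axioms N.finite_measure_axioms)
  also have "\<dots> = (\<integral>\<^sup>+z. \<integral>\<^sup>+x. ennreal (normal_density 0 \<sigma> (x - z)) * indicator A x \<partial>lborel \<partial>Q)"
  proof (intro nn_integral_cong)
    fix z
    have "(\<integral>\<^sup>+y. indicator A (z + y) \<partial>normal_measure \<sigma>)
        = (\<integral>\<^sup>+y. ennreal (normal_density 0 \<sigma> y) * indicator A (z + y) \<partial>lborel)"
      unfolding normal_measure_def by (subst nn_integral_density) auto
    also have "\<dots> = (\<integral>\<^sup>+x. ennreal (normal_density 0 \<sigma> (x - z)) * indicator A x \<partial>lborel)"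
      by (subst nn_integral_real_affine[of "\<lambda>x. ennreal (normal_density 0 \<sigma> (x - z)) * indicator A x" 1 z])
        auto
    finally show "(\<integral>\<^sup>+y. indicator A (z + y) \<partial>normal_measure \<sigma>)
        = (\<integral>\<^sup>+x. ennreal (normal_density 0 \<sigma> (x - z)) * indicator A x \<partial>lborel)" .
  qed
  also have "\<dots> = (\<integral>\<^sup>+x. \<integral>\<^sup>+z. ennreal (normal_density 0 \<sigma> (x - z)) * indicator A x \<partial>Q \<partial>lborel)"
    by (rule QL.Fubini'[symmetric]) measurable
  also have "\<dots> = (\<integral>\<^sup>+x. ennreal (gauss_smooth Q \<sigma> x) * indicator A x \<partial>lborel)"
    unfolding gauss_smooth_def
    by (intro nn_integral_cong)
      (auto simp: nn_integral_multc nn_integral_eq_integral integrable_normal_density_shift)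
  also have "\<dots> = emeasure (density lborel (\<lambda>x. ennreal (gauss_smooth Q \<sigma> x))) A"
    by (simp add: emeasure_density)
  finally show "emeasure (convolution Q (normal_measure \<sigma>)) A
      = emeasure (density lborel (\<lambda>x. ennreal (gauss_smooth Q \<sigma> x))) A" .
qed simp

lemma gauss_smooth_mass: "(\<integral>\<^sup>+x. ennreal (gauss_smooth Q \<sigma> x) \<partial>lborel) = 1"
proof -
  interpret N: prob_space "normal_measure \<sigma>" by (rule prob_space_normal_measure[OF \<sigma>])
  interpret QN: pair_prob_space Q "normal_measure \<sigma>" ..
  have "prob_space (convolution Q (normal_measure \<sigma>))"
    unfolding convolution_def by (rule QN.prob_space_distr) measurable
  from prob_space.emeasure_space_1[OF this] show ?thesis
    by (simp add: convolution_normal_measure_eq_density emeasure_density)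
qed

end

section \<open>Laws without a normal component\<close>

lemma continuous_AE_lborel_eq:
  fixes f g :: "real \<Rightarrow> real"
  assumes "continuous_on UNIV f" "continuous_on UNIV g" "AE x in lborel. f x = g x"
  shows "f x = g x"
proof -
  \<comment> \<open>A closed set of full Lebesgue measure is the whole line.\<close>
  have "closed {x. f x = g x}"
    using assms by (intro closed_Collect_eq)
  moreover have "AE x in lebesgue. x \<in> {x. f x = g x}"
    using assms(3) by (auto intro: AE_completion)
  ultimately show ?thesis
    using mem_closed_if_AE_lebesgue by blast
qed

text \<open>A law with a normal component has a Lebesgue density and hence no atoms.\<close>

lemma return_in_NNorm: "return borel c \<in> NNorm"
proof -
  have False if "return borel c = convolution Q (normal_measure \<sigma>)" "0 < \<sigma>" "Q \<in> prob_distrs" for Q \<sigma>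
  proof -
    note [measurable] = gauss_smooth_measurable[OF that(3,2)]
    have "1 = emeasure (return borel c) {c}" by simp
    also have "\<dots> = emeasure (density lborel (\<lambda>x. ennreal (gauss_smooth Q \<sigma> x))) {c}"
      using that by (simp add: convolution_normal_measure_eq_density)
    also have "\<dots> = 0"
      by (subst emeasure_density) (auto simp: nn_integral_indicator_singleton)
    finally show False by simp
  qed
  then show ?thesis by (auto simp: NNorm_def)
qed

text \<open>A normal component would give a second continuous density, positive everywhere. Two
  continuous densities of one law agree at every point, which fails at \<open>x0\<close>.\<close>

lemma density_with_zero_in_NNorm:
  assumes f: "continuous_on UNIV f" "\<And>x. 0 \<le> f x" "f x0 = (0::real)"
  shows "density lborel (\<lambda>x. ennreal (f x)) \<in> NNorm"
proof -
  have False if eq: "density lborel (\<lambda>x. ennreal (f x)) = convolution Q (normal_measure \<sigma>)"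
    and "0 < \<sigma>" "Q \<in> prob_distrs" for Q \<sigma>
  proof -
    note [measurable] = gauss_smooth_measurable[OF that(3,2)] borel_measurable_continuous_onI[OF f(1)]
    note pos = gauss_smooth_pos[OF that(3,2)]
    have "AE x in lborel. ennreal (f x) = ennreal (gauss_smooth Q \<sigma> x)"
      using eq that by (intro sigma_finite_measure.density_unique[OF sigma_finite_lborel]) (auto simp: convolution_normal_measure_eq_density)
    then have "AE x in lborel. f x = gauss_smooth Q \<sigma> x"
      by eventually_elim (use f(2) pos in \<open>auto simp: less_imp_le\<close>)
    then have "f x0 = gauss_smooth Q \<sigma> x0"
      using continuous_AE_lborel_eq[OF f(1) continuous_gauss_smooth] that by blast
    then show False using f(3) pos[of x0] by simp
  qed
  then show ?thesis by (auto simp: NNorm_def)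
qed

section \<open>Comparison with a narrower Gaussian\<close>

lemma gaussian_ratio_tendsto_infinity:
  assumes "0 < v" "v < \<sigma>"
  shows "filterlim (\<lambda>x. normal_density 0 \<sigma> (x + m) / normal_density 0 v x) at_top at_top"
proof -
  define \<alpha> \<beta> where "\<alpha> = 1 / (2 * v\<^sup>2)" and "\<beta> = 1 / (2 * \<sigma>\<^sup>2)"
  have "v\<^sup>2 < \<sigma>\<^sup>2" using assms by (simp add: power_strict_mono)
  then have "\<beta> < \<alpha>" using assms by (auto simp: \<alpha>_def \<beta>_def field_simps)
  have "normal_density 0 \<sigma> y = exp (- (\<beta> * y\<^sup>2)) / sqrt (2 * pi * \<sigma>\<^sup>2)"
    "normal_density 0 v y = exp (- (\<alpha> * y\<^sup>2)) / sqrt (2 * pi * v\<^sup>2)" for y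
    by (simp_all add: normal_density_def \<alpha>_def \<beta>_def)
  then have "normal_density 0 \<sigma> (x + m) / normal_density 0 v x
      = sqrt (2 * pi * v\<^sup>2) / sqrt (2 * pi * \<sigma>\<^sup>2) * exp (\<alpha> * x\<^sup>2 - \<beta> * (x + m)\<^sup>2)" for x
    by (simp add: exp_diff exp_minus divide_inverse mult_ac)
  moreover have "filterlim (\<lambda>x. C * exp (\<alpha> * x\<^sup>2 - \<beta> * (x + m)\<^sup>2)) at_top at_top" if "0 < C" for C :: real
  proof -
    \<comment> \<open>The factored exponent exposes its leading coefficient
      \<open>\<alpha> - \<beta>\<close>, positive because \<open>v < \<sigma>\<close>.\<close>
    have "filterlim (\<lambda>x. x * ((\<alpha> - \<beta>) * x - 2 * \<beta> * m) - \<beta> * m\<^sup>2) at_top at_top"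
      using \<open>\<beta> < \<alpha>\<close> by real_asymp
    also have "(\<lambda>x. x * ((\<alpha> - \<beta>) * x - 2 * \<beta> * m) - \<beta> * m\<^sup>2) = (\<lambda>x. \<alpha> * x\<^sup>2 - \<beta> * (x + m)\<^sup>2)"
      by (auto simp: algebra_simps power2_eq_square)
    finally show ?thesis
      using that by (intro filterlim_tendsto_pos_mult_at_top[OF tendsto_const]
          filterlim_compose[OF exp_at_top])
  qed
  ultimately show ?thesis using assms by (simp del: times_divide_eq_left)
qed

text \<open>The constant \<open>c\<close> is the minimum of the quotient \<open>r\<close> of the two
  densities. It is attained because \<open>r\<close> exceeds \<open>r 0\<close> outside a compact
  interval; it is below 1 because both densities have mass 1 and \<open>r\<close> is not
  constant.\<close>

lemma gauss_smooth_touches_narrow_gaussian: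
  assumes Q: "Q \<in> prob_distrs" and v: "0 < v" "v < \<sigma>"
  obtains c x0 where "0 \<le> c" "c < 1" "\<And>x. c * normal_density 0 v x \<le> gauss_smooth Q \<sigma> x"
    "gauss_smooth Q \<sigma> x0 = c * normal_density 0 v x0"
proof -
  have \<sigma>: "0 < \<sigma>" using v by simp
  note [measurable] = gauss_smooth_measurable[OF Q \<sigma>]
  define r where "r x = gauss_smooth Q \<sigma> x / normal_density 0 v x" for x
  have hpos: "0 < normal_density 0 v x" for x using v by (simp add: normal_density_pos)
  have hcont: "continuous_on UNIV (normal_density 0 v)"
    unfolding normal_density_def using v by (intro continuous_intros) auto
  obtain m where m: "\<And>x. normal_density 0 \<sigma> (\<bar>x\<bar> + m) / 2 \<le> gauss_smooth Q \<sigma> x"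
    using gauss_smooth_lower_bound[OF Q \<sigma>] by metis
  \<comment> \<open>The factor 2 pays for the division by 2 in the lower bound
    \<open>m\<close>.\<close>
  have "eventually (\<lambda>x. normal_density 0 \<sigma> (x + m) / normal_density 0 v x > 2 * r 0) at_top"
    using gaussian_ratio_tendsto_infinity[OF v] by (auto simp: filterlim_at_top_dense)
  then obtain R0 where R0: "\<And>x. x \<ge> R0 \<Longrightarrow> normal_density 0 \<sigma> (x + m) / normal_density 0 v x > 2 * r 0"
    by (auto simp: eventually_at_top_linorder)
  \<comment> \<open>With \<open>R\<close> at least 1, the interval \<open>{-R..R}\<close> contains
    0, so the minimum over it is at most \<open>r 0\<close> and therefore global.\<close>
  define R where "R = max R0 1"
  then have "1 \<le> R" by simp
  have far: "r 0 < r x" if "\<bar>x\<bar> \<ge> R" for x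
  proof -
    have "r 0 < normal_density 0 \<sigma> (\<bar>x\<bar> + m) / normal_density 0 v \<bar>x\<bar> / 2"
      using R0[of "\<bar>x\<bar>"] that by (simp add: R_def)
    also have "\<dots> = normal_density 0 \<sigma> (\<bar>x\<bar> + m) / 2 / normal_density 0 v x"
      by (simp add: normal_density_def)
    also have "\<dots> \<le> r x"
      unfolding r_def by (intro divide_right_mono m) simp
    finally show ?thesis .
  qed
  have "continuous_on {-R..R} r"
    unfolding r_def using hpos
    by (intro continuous_on_divide continuous_on_subset[OF continuous_gauss_smooth[OF Q \<sigma>]]
        continuous_on_subset[OF hcont]) (auto simp: less_imp_neq[THEN not_sym])
  then obtain x0 where x0: "x0 \<in> {-R..R}" "\<And>x. x \<in> {-R..R} \<Longrightarrow> r x0 \<le> r x"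
    using continuous_attains_inf[of "{-R..R}" r] \<open>1 \<le> R\<close> by auto
  have min: "r x0 \<le> r x" for x
  proof (cases "x \<in> {-R..R}")
    case False
    then have "r 0 < r x" by (intro far) auto
    moreover have "r x0 \<le> r 0" by (intro x0) (auto simp: R_def)
    ultimately show ?thesis by simp
  qed (rule x0)
  define c where "c = r x0"
  have le: "c * normal_density 0 v x \<le> gauss_smooth Q \<sigma> x" for x
    using min[of x] hpos[of x] by (simp add: c_def r_def[of x] field_simps)
  have c0: "0 \<le> c" using gauss_smooth_pos[OF Q \<sigma>, of x0] hpos[of x0] by (simp add: c_def r_def)
  have "c < 1"
  proof (rule ccontr)
    \<comment> \<open>Then the narrow density lies below \<open>gauss_smooth Q \<sigma>\<close>.
      Equal masses force equality almost everywhere, hence everywhere by continuity, so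
      \<open>r\<close> is constantly 1, against \<open>r 0 < r R\<close>.\<close>
    assume "\<not> c < 1"
    then have "normal_density 0 v x \<le> c * normal_density 0 v x" for x
      using hpos[of x] by simp
    with le have le': "normal_density 0 v x \<le> gauss_smooth Q \<sigma> x" for x
      using order_trans by blast
    note mass = gauss_smooth_mass[OF Q \<sigma>]
    have mass': "(\<integral>\<^sup>+x. ennreal (normal_density 0 v x) \<partial>lborel) = 1"
      using v by (subst nn_integral_eq_integral) auto
    have "AE x in lborel. ennreal (normal_density 0 v x) = ennreal (gauss_smooth Q \<sigma> x)"
    proof -
      have "(\<integral>\<^sup>+x. ennreal (gauss_smooth Q \<sigma> x) - ennreal (normal_density 0 v x) \<partial>lborel) = 0"
        using mass mass' le' by (subst nn_integral_diff) (auto intro: ennreal_leI)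
      then have "AE x in lborel. ennreal (gauss_smooth Q \<sigma> x) - ennreal (normal_density 0 v x) = 0"
        by (subst (asm) nn_integral_0_iff_AE) auto
      then show ?thesis
        by eventually_elim
          (use le' in \<open>auto simp: ennreal_minus gauss_smooth_pos[OF Q \<sigma>] intro!: arg_cong[where f = ennreal] antisym\<close>)
    qed
    then have "AE x in lborel. normal_density 0 v x = gauss_smooth Q \<sigma> x"
      by eventually_elim (use gauss_smooth_pos[OF Q \<sigma>] in \<open>auto simp: less_imp_le\<close>)
    from continuous_AE_lborel_eq[OF hcont continuous_gauss_smooth[OF Q \<sigma>] this]
    have "r x = 1" for x
      using hpos[of x] by (simp add: r_def)
    then show False using far[of R] by (simp add: R_def)
  qed
  moreover have "gauss_smooth Q \<sigma> x0 = c * normal_density 0 v x0"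
    using hpos[of x0] by (simp add: c_def r_def)
  ultimately show thesis using that c0 le by blast
qed

section \<open>Mixtures supported on two scales\<close>

lemma sets_borel_Times: "sets (borel :: (real \<times> real) measure) = sets (borel \<Otimes>\<^sub>M borel)"
  by (simp only: borel_prod)

text \<open>As the image of a product of a Bernoulli law with \<open>K\<close>, the mixture is a
  probability law at once, and integrals against it reduce to Fubini and a sum of two terms.\<close>

definition two_point :: "real \<Rightarrow> real measure \<Rightarrow> real \<Rightarrow> real \<Rightarrow> (real \<times> real) measure" where
  "two_point p K s t = distr (measure_pmf (bernoulli_pmf p) \<Otimes>\<^sub>M K) borel
     (\<lambda>(c, x). if c then (x, s) else (0, t))"

context
  fixes p s t :: real and K :: "real measure"
  assumes p: "0 \<le> p" "p \<le> 1" and K: "K \<in> prob_distrs"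
begin

interpretation K: real_distribution K by (rule prob_distrs_real_distribution[OF K])

interpretation BK: pair_prob_space "measure_pmf (bernoulli_pmf p)" K ..

lemma two_point_map_measurable [measurable]:
  "(\<lambda>(c, x). if c then (x, s) else (0, t)) \<in> measure_pmf (bernoulli_pmf p) \<Otimes>\<^sub>M K \<rightarrow>\<^sub>M borel"
  unfolding split_beta' by (intro measurable_If borel_measurable_Pair) measurable

lemma two_point_in_prob_distrs: "two_point p K s t \<in> prob_distrs"
  unfolding prob_distrs_def two_point_def by (auto intro!: BK.prob_space_distr)

lemma nn_integral_two_point:
  assumes [measurable]: "G \<in> borel_measurable borel"
  shows "(\<integral>\<^sup>+z. G z \<partial>two_point p K s t)
    = ennreal p * (\<integral>\<^sup>+x. G (x, s) \<partial>K) + ennreal (1 - p) * G (0, t)"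
proof -
  have "(\<integral>\<^sup>+z. G z \<partial>two_point p K s t)
      = (\<integral>\<^sup>+c. \<integral>\<^sup>+x. G (if c then (x, s) else (0, t)) \<partial>K \<partial>measure_pmf (bernoulli_pmf p))"
    unfolding two_point_def
    by (subst nn_integral_distr) (auto simp: K.nn_integral_fst[symmetric])
  also have "\<dots> = ennreal p * (\<integral>\<^sup>+x. G (x, s) \<partial>K) + ennreal (1 - p) * G (0, t)"
    using p K.emeasure_space_1 by (subst nn_integral_bernoulli_pmf) (auto simp: mult.commute)
  finally show ?thesis .
qed

lemma emeasure_two_point:
  assumes [measurable]: "A \<in> sets borel"
  shows "emeasure (two_point p K s t) A
    = ennreal p * emeasure K {x. (x, s) \<in> A} + ennreal (1 - p) * indicator A (0, t)"
proof -
  have "(\<integral>\<^sup>+x. indicator A (x, s) \<partial>K) = emeasure K {x. (x, s) \<in> A}"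
  proof -
    have [measurable]: "(\<lambda>x::real. (x, s)) \<in> borel \<rightarrow>\<^sub>M borel" by (intro borel_measurable_Pair) auto
    have "{x. (x, s) \<in> A} = (\<lambda>x. (x, s)) -` A \<inter> space borel" by auto
    also have "\<dots> \<in> sets K" unfolding K.events_eq_borel by measurable
    finally have "{x. (x, s) \<in> A} \<in> sets K" .
    then have "emeasure K {x. (x, s) \<in> A} = (\<integral>\<^sup>+x. indicator {x. (x, s) \<in> A} x \<partial>K)"
      by simp
    then show ?thesis by (simp add: indicator_def)
  qed
  then show ?thesis
    using nn_integral_two_point[of "indicator A"] two_point_in_prob_distrs
    by (simp add: prob_distrsD(2))
qed

lemma Fmix_two_point:
  "Fmix y (two_point p K s t) = p * (\<integral>x. Phi_kernel y x s \<partial>K) + (1 - p) * Phi_kernel y 0 t"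
proof -
  have "Fmix y (two_point p K s t)
      = (\<integral>z. Phi_kernel y (if fst z then snd z else 0) (if fst z then s else t)
          \<partial>(measure_pmf (bernoulli_pmf p) \<Otimes>\<^sub>M K))"
    unfolding Fmix_def two_point_def
    by (subst integral_distr)
      (auto simp: borel_prod[symmetric] split_beta' if_distrib cong: if_cong
        intro!: Bochner_Integration.integral_cong)
  also have "\<dots> = (\<integral>c. \<integral>x. Phi_kernel y (if c then x else 0) (if c then s else t)
      \<partial>K \<partial>measure_pmf (bernoulli_pmf p))"
  proof -
    have [measurable]: "fst \<in> measure_pmf (bernoulli_pmf p) \<Otimes>\<^sub>M K \<rightarrow>\<^sub>M count_space UNIV"
      using measurable_fst[of "measure_pmf (bernoulli_pmf p)" K] by simp
    have "integrable (measure_pmf (bernoulli_pmf p) \<Otimes>\<^sub>M K)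
        (\<lambda>z. Phi_kernel y (if fst z then snd z else 0) (if fst z then s else t))"
      by (rule BK.P.integrable_const_bound[where B = 1]) (auto simp: abs_Phi_kernel_le)
    from BK.integral_fst'[OF this] show ?thesis by (simp cong: if_cong)
  qed
  also have "\<dots> = p * (\<integral>x. Phi_kernel y x s \<partial>K) + (1 - p) * Phi_kernel y 0 t"
    using p K.prob_space by (subst integral_bernoulli_pmf) auto
  finally show ?thesis .
qed

lemma two_point_in_P_NCN:
  assumes "s \<noteq> t" "s \<in> {a..b}" "t \<in> {a..b}" "K \<in> NNorm"
  shows "two_point p K s t \<in> P_NCN UNIV {a..b}"
proof -
  let ?P = "two_point p K s t"
  \<comment> \<open>Scales other than \<open>s\<close> and \<open>t\<close> have probability zero,
    but \<open>P_NCN\<close> asks for a law in \<open>NNorm\<close> at every scale of the interval;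
    \<open>K\<close> serves there too.\<close>
  define L where "L u = (if u = t then return borel 0 else K)" for u :: real
  have Lm: "L \<in> borel \<rightarrow>\<^sub>M subprob_algebra borel"
    unfolding L_def
    by (intro measurable_If measurable_const)
      (auto simp: space_subprob_algebra K.events_eq_borel K.subprob_space_axioms intro!: prob_space_imp_subprob_space prob_space_return)
  have Lp: "L u \<in> prob_distrs" for u
    using K by (auto simp: L_def prob_distrs_def intro: prob_space_return)
  have snd [measurable]: "snd \<in> ?P \<rightarrow>\<^sub>M (borel :: real measure)"
    using prob_distrsD(2)[OF two_point_in_prob_distrs] by (simp cong: measurable_cong_sets add: borel_prod[symmetric])
  have "emeasure ?P A = (\<integral>\<^sup>+u. emeasure (L u) {x. (x, u) \<in> A} \<partial>distr ?P borel snd)"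
    if A [measurable]: "A \<in> sets borel" for A
  proof -
    have A': "A \<in> sets (borel \<Otimes>\<^sub>M borel)" using A by (simp only: sets_borel_Times)
    \<comment> \<open>Swapping coordinates presents the sections of \<open>A\<close> as a family
      indexed by the scale, the form in which measurability of the kernel applies.\<close>
    have "(\<lambda>(x, y). (y, x)) -` A \<inter> space (borel \<Otimes>\<^sub>M borel) \<in> sets (borel \<Otimes>\<^sub>M borel)"
      by (rule measurable_sets[OF measurable_pair_swap' A'])
    also have "(\<lambda>(x, y). (y, x)) -` A \<inter> space (borel \<Otimes>\<^sub>M borel)
        = (SIGMA u:space borel. {x. (x, u) \<in> A})"
      by (auto simp: space_pair_measure)
    finally have meas [measurable]: "(\<lambda>u. emeasure (L u) {x. (x, u) \<in> A}) \<in> borel_measurable borel"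
      using Lm by (rule emeasure_measurable_subprob_algebra2)
    have sec: "{x. (x, u) \<in> A} \<in> sets borel" for u
      using sets_Pair2[OF A', of u] by (simp add: vimage_def)
    have "(\<integral>\<^sup>+u. emeasure (L u) {x. (x, u) \<in> A} \<partial>distr ?P borel snd)
        = (\<integral>\<^sup>+z. emeasure (L (snd z)) {x. (x, snd z) \<in> A} \<partial>?P)"
      by (subst nn_integral_distr) auto
    also have "\<dots> = ennreal p * emeasure (L s) {x. (x, s) \<in> A} + ennreal (1 - p) * emeasure (L t) {x. (x, t) \<in> A}"
      by (subst nn_integral_two_point) (auto simp: borel_prod[symmetric] K.emeasure_space_1 simp del: K.space_eq_univ)
    also have "\<dots> = emeasure ?P A"
      using assms(1) sec by (simp add: emeasure_two_point L_def indicator_def)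
    finally show ?thesis by simp
  qed
  then have cond: "cond_law_X_given_S ?P L"
    using Lm Lp by (auto simp: cond_law_X_given_S_def)
  have "msupport ?P \<subseteq> UNIV \<times> {a..b}"
  proof -
    \<comment> \<open>The complement of the strip is open and null, so it contains no support
      point.\<close>
    let ?U = "UNIV \<times> (- {a..b}) :: (real \<times> real) set"
    have o: "open ?U" by (intro open_Times) auto
    have "emeasure ?P ?U = 0"
      using assms o by (subst emeasure_two_point) auto
    then show ?thesis using o by (force simp: msupport_def)
  qed
  moreover have "L u \<in> NNorm" for u
    using assms(4) by (simp add: L_def return_in_NNorm)
  ultimately show ?thesis
    using cond two_point_in_prob_distrs by (auto simp: P_NCN_def Pset_def)
qed

end

text \<open>Removing \<open>s\<close> and \<open>t\<close> from the open interval of scales leaves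
  an open strip that the mixture does not charge but that still meets the support of
  \<open>P\<close>.\<close>

lemma two_point_neq_of_strip_support:
  assumes p: "0 \<le> p" "p \<le> 1" and K: "K \<in> prob_distrs"
    and supp: "msupport P = UNIV \<times> {u..v}" "u < v"
  shows "two_point p K s t \<noteq> P"
proof
  assume eq: "two_point p K s t = P"
  have "infinite ({u<..<v} - {s, t})"
    using supp(2) by (simp add: infinite_Ioo)
  then obtain w where w: "w \<in> {u<..<v} - {s, t}"
    by (metis equals0I finite.emptyI)
  let ?U = "UNIV \<times> ({u<..<v} - {s, t}) :: (real \<times> real) set"
  have U: "open ?U"
    by (intro open_Times open_Diff finite_imp_closed) auto
  have "(0, w) \<in> msupport P"
    using w by (simp add: supp)
  then have "emeasure P ?U \<noteq> 0"
    using U w by (auto simp: msupport_def)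
  moreover have "emeasure P ?U = 0"
    using U by (subst eq[symmetric], subst emeasure_two_point[OF p K]) auto
  ultimately show False by simp
qed

section \<open>Rewriting the law of the observation\<close>

lemma ex_location_law_at_scale:
  assumes P: "P \<in> prob_distrs" and supp: "msupport P \<subseteq> UNIV \<times> {a..}" and a: "0 \<le> a"
  obtains M where "M \<in> prob_distrs" "\<And>y. (\<integral>x. Phi_kernel y x a \<partial>M) = Fmix y P"
proof -
  interpret P: prob_space P by (rule prob_distrsD[OF P])
  interpret N: prob_space "normal_measure 1" by (rule prob_space_normal_measure) simp
  interpret PN: pair_prob_space P "normal_measure 1" ..
  have [measurable_cong]: "sets P = sets (borel \<Otimes>\<^sub>M borel)"
    using prob_distrsD(2)[OF P] sets_borel_Times by simp
  \<comment> \<open>The variance splits as \<open>S^2 = (S^2 - a^2) + a^2\<close>: the first part is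
    absorbed into the location, the second stays as noise of the fixed scale
    \<open>a\<close>.\<close>
  define T where "T = (\<lambda>z. fst (fst z) + sqrt ((snd (fst z))\<^sup>2 - a\<^sup>2) * snd z :: real)"
  have T [measurable]: "T \<in> P \<Otimes>\<^sub>M normal_measure 1 \<rightarrow>\<^sub>M borel"
    unfolding T_def by measurable
  define M where "M = distr (P \<Otimes>\<^sub>M normal_measure 1) borel T"
  \<comment> \<open>Almost surely the scale is at least \<open>a\<close>, so
    \<open>S^2 - a^2\<close> is nonnegative and really is the square of its root.\<close>
  have "emeasure P (UNIV \<times> {..<a}) = 0"
    using supp by (intro emeasure_open_disjoint_msupport prob_distrsD[OF P] open_Times) auto
  moreover have "UNIV \<times> {..<a} \<in> sets P"
    using prob_distrsD(2)[OF P] by (simp add: open_Times borel_open)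
  ultimately have AE: "AE z in P. a \<le> snd z"
    by (intro AE_I'[of "UNIV \<times> {..<a}"]) (auto simp: null_sets_def)
  have "(\<integral>x. Phi_kernel y x a \<partial>M) = Fmix y P" for y
  proof -
    have "(\<integral>x. Phi_kernel y x a \<partial>M) = (\<integral>z. Phi_kernel y (T z) a \<partial>(P \<Otimes>\<^sub>M normal_measure 1))"
      unfolding M_def by (rule integral_distr) measurable
    also have "\<dots> = (\<integral>z. \<integral>e. Phi_kernel y (T (z, e)) a \<partial>normal_measure 1 \<partial>P)"
      by (rule PN.integral_fst'[symmetric], rule PN.P.integrable_const_bound[where B = 1])
        (auto simp: abs_Phi_kernel_le)
    also have "\<dots> = (\<integral>z. Phi_kernel y (fst z) (snd z) \<partial>P)"
    proof (rule integral_cong_AE)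
      show "AE z in P. (\<integral>e. Phi_kernel y (T (z, e)) a \<partial>normal_measure 1) = Phi_kernel y (fst z) (snd z)"
        using AE
      proof eventually_elim
        case (elim z)
        then have "a\<^sup>2 \<le> (snd z)\<^sup>2" using a by simp
        then show ?case
          using integral_Phi_kernel_std_normal[OF a, of "sqrt ((snd z)\<^sup>2 - a\<^sup>2)" y "fst z"] a elim
          by (simp add: T_def)
      qed
    qed measurable
    finally show ?thesis by (simp add: Fmix_def)
  qed
  moreover have "M \<in> prob_distrs"
    unfolding prob_distrs_def M_def by (auto intro: PN.P.prob_space_distr)
  ultimately show thesis using that by blast
qed

text \<open>Subtract from the density of the convolution the largest multiple \<open>c\<close> of
  the narrow Gaussian that fits below it. The normalised remainder \<open>K\<close> has a zero,
  hence no normal component. The removed Gaussian, observed at scale \<open>a\<close>, is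
  indistinguishable from location 0 at scale \<open>sqrt (a^2 + v^2)\<close>. The weight is
  \<open>p = 1 - c\<close>.\<close>

lemma split_off_atom_no_normal_component:
  assumes Q: "Q \<in> prob_distrs" and v: "0 < v" "v < \<sigma>" and a: "0 \<le> a"
  obtains p K where "0 \<le> p" "p \<le> 1" "K \<in> prob_distrs" "K \<in> NNorm"
    "\<And>y. p * (\<integral>x. Phi_kernel y x a \<partial>K) + (1 - p) * Phi_kernel y 0 (sqrt (a\<^sup>2 + v\<^sup>2))
      = (\<integral>x. Phi_kernel y x a \<partial>convolution Q (normal_measure \<sigma>))"
proof -
  have \<sigma>: "0 < \<sigma>" using v by simp
  let ?g = "gauss_smooth Q \<sigma>" and ?h = "normal_density 0 v"
  obtain c x0 where c: "0 \<le> c" "c < 1" "\<And>x. c * ?h x \<le> ?g x" "?g x0 = c * ?h x0"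
    using gauss_smooth_touches_narrow_gaussian[OF Q v] by blast
  note [measurable] = gauss_smooth_measurable[OF Q \<sigma>]
  define f where "f x = (?g x - c * ?h x) / (1 - c)" for x
  have fpos: "0 \<le> f x" for x using c by (simp add: f_def)
  have fm [measurable]: "f \<in> borel_measurable borel" unfolding f_def by measurable
  define K where "K = density lborel (\<lambda>x. ennreal (f x))"
  have "?h = (\<lambda>x. 1 / sqrt (2 * pi * v\<^sup>2) * exp (-(x - 0)\<^sup>2/ (2 * v\<^sup>2)))"
    by (auto simp: normal_density_def)
  then have "continuous_on UNIV ?h"
    using v by (auto intro!: continuous_intros)
  then have "continuous_on UNIV f"
    unfolding f_def using c(2) by (intro continuous_intros continuous_gauss_smooth[OF Q \<sigma>]) auto
  then have KN: "K \<in> NNorm"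
    unfolding K_def using c(4) fpos by (intro density_with_zero_in_NNorm[of f x0]) (auto simp: f_def)
  have gi: "integrable lborel ?g" and g1: "(\<integral>x. ?g x \<partial>lborel) = 1"
    using gauss_smooth_mass[OF Q \<sigma>] gauss_smooth_pos[OF Q \<sigma>]
    by (auto simp: less_imp_le intro!: integrableI_nonneg integral_eq_nn_integral[THEN trans])
  have hi: "integrable lborel ?h" and h1: "(\<integral>x. ?h x \<partial>lborel) = 1" using v by auto
  \<comment> \<open>Both densities have mass 1, so the remainder has mass
    \<open>(1 - c) / (1 - c)\<close>.\<close>
  have fi: "integrable lborel f" and f1: "(\<integral>x. f x \<partial>lborel) = 1"
    unfolding f_def using gi hi g1 h1 c(2) by auto
  have K: "K \<in> prob_distrs"
    unfolding prob_distrs_def K_def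
    using fi f1 fpos by (auto intro!: prob_spaceI simp: emeasure_density nn_integral_eq_integral)
  have "(1 - c) * (\<integral>x. Phi_kernel y x a \<partial>K) + (1 - (1 - c)) * Phi_kernel y 0 (sqrt (a\<^sup>2 + v\<^sup>2))
      = (\<integral>x. Phi_kernel y x a \<partial>convolution Q (normal_measure \<sigma>))" for y
  proof -
    let ?k = "\<lambda>x. Phi_kernel y x a"
    \<comment> \<open>The kernel is bounded by 1, so each product is integrable and the integral of
      the difference may be split.\<close>
    have bi: "integrable lborel (\<lambda>x. w x * ?k x)" if "integrable lborel w" for w :: "real \<Rightarrow> real"
    proof (rule Bochner_Integration.integrable_bound[OF that])
      have [measurable]: "w \<in> borel_measurable borel" using that by auto
      show "(\<lambda>x. w x * ?k x) \<in> borel_measurable lborel" by measurable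
      show "AE x in lborel. norm (w x * ?k x) \<le> norm (w x)"
        using abs_Phi_kernel_le by (auto simp: abs_mult intro!: mult_left_le)
    qed
    have "Phi_kernel y 0 (sqrt (a\<^sup>2 + v\<^sup>2)) = (\<integral>x. ?k x \<partial>normal_measure v)"
      using integral_Phi_kernel_normal[OF a v(1), of y 0] by simp
    also have "\<dots> = (\<integral>x. ?h x * ?k x \<partial>lborel)"
      unfolding normal_measure_def by (subst integral_density) auto
    finally have 1: "Phi_kernel y 0 (sqrt (a\<^sup>2 + v\<^sup>2)) = (\<integral>x. ?h x * ?k x \<partial>lborel)" .
    have 2: "(\<integral>x. ?k x \<partial>convolution Q (normal_measure \<sigma>)) = (\<integral>x. ?g x * ?k x \<partial>lborel)"
      unfolding convolution_normal_measure_eq_density[OF Q \<sigma>]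
      using gauss_smooth_pos[OF Q \<sigma>] by (subst integral_density) (auto simp: less_imp_le)
    have "(1 - c) * (\<integral>x. ?k x \<partial>K) = (1 - c) * (\<integral>x. f x * ?k x \<partial>lborel)"
      unfolding K_def using fpos by (subst integral_density) auto
    also have "\<dots> = (\<integral>x. (1 - c) * (f x * ?k x) \<partial>lborel)" by simp
    also have "\<dots> = (\<integral>x. ?g x * ?k x - c * (?h x * ?k x) \<partial>lborel)"
    proof (intro Bochner_Integration.integral_cong refl)
      fix x
      have "(1 - c) * f x = ?g x - c * ?h x" using c(2) by (simp add: f_def)
      then show "(1 - c) * (f x * ?k x) = ?g x * ?k x - c * (?h x * ?k x)"
        by (simp add: mult.assoc[symmetric] left_diff_distrib)
    qed
    also have "\<dots> = (\<integral>x. ?g x * ?k x \<partial>lborel) - c * (\<integral>x. ?h x * ?k x \<partial>lborel)"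
      using bi[OF gi] bi[OF hi] by simp
    finally show ?thesis using 1 2 by simp
  qed
  then show thesis using that[of "1 - c" K] c K KN by simp
qed

theorem theorem1:
  fixes a b :: real
  assumes "0 \<le> a" and "a < b"
  shows "\<forall>Pbar \<in> P_NCN UNIV {a..b}.
           (\<exists>abar bbar. a \<le> abar \<and> abar < bbar \<and> bbar \<le> b \<and>
              msupport Pbar = UNIV \<times> {abar..bbar}) \<longrightarrow>
           (\<exists>P \<in> P_NCN UNIV {a..b}. P \<noteq> Pbar \<and> (\<forall>y. Fmix y P = Fmix y Pbar))"
proof (intro ballI impI, elim exE conjE)
  fix Pbar abar bbar
  assume "Pbar \<in> P_NCN UNIV {a..b}" and supp: "msupport Pbar = UNIV \<times> {abar..bbar}"
    and ab: "a \<le> abar" "abar < bbar" "bbar \<le> b"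
  then have Pbar: "Pbar \<in> prob_distrs" by (auto simp: P_NCN_def Pset_def)
  \<comment> \<open>Both cases below end in a two-scale mixture with first scale \<open>a\<close>;
    only \<open>p\<close>, \<open>K\<close> and \<open>t\<close> differ.\<close>
  have conclude: "\<exists>P \<in> P_NCN UNIV {a..b}. P \<noteq> Pbar \<and> (\<forall>y. Fmix y P = Fmix y Pbar)"
    if "0 \<le> p" "p \<le> 1" "K \<in> prob_distrs" "K \<in> NNorm" "a < t" "t \<le> b"
      "\<And>y. p * (\<integral>x. Phi_kernel y x a \<partial>K) + (1 - p) * Phi_kernel y 0 t = Fmix y Pbar" for p K t
  proof (intro bexI conjI allI)
    show "two_point p K a t \<in> P_NCN UNIV {a..b}"
      using that assms by (intro two_point_in_P_NCN) auto
    show "two_point p K a t \<noteq> Pbar"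
      by (rule two_point_neq_of_strip_support[OF that(1-3) supp ab(2)])
    show "Fmix y (two_point p K a t) = Fmix y Pbar" for y
      using that by (simp add: Fmix_two_point)
  qed
  have "msupport Pbar \<subseteq> UNIV \<times> {a..}" using supp ab(1) by auto
  then obtain M where M: "M \<in> prob_distrs" "\<And>y. (\<integral>x. Phi_kernel y x a \<partial>M) = Fmix y Pbar"
    using ex_location_law_at_scale[OF Pbar _ assms(1)] by metis
  show "\<exists>P \<in> P_NCN UNIV {a..b}. P \<noteq> Pbar \<and> (\<forall>y. Fmix y P = Fmix y Pbar)"
  proof (cases "M \<in> NNorm")
    case True
    \<comment> \<open>With \<open>p = 1\<close> the second atom has weight 0, so \<open>b\<close>
      merely fills the place of a scale in \<open>(a, b]\<close>.\<close>
    then show ?thesis using conclude[of 1 M b] M assms by simp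
  next
    case False
    then obtain Q \<sigma> where Q: "0 < \<sigma>" "Q \<in> prob_distrs" "M = convolution Q (normal_measure \<sigma>)"
      by (auto simp: NNorm_def)
    \<comment> \<open>The bound \<open>\<sigma> / 2\<close> makes the Gaussian to be removed
      strictly narrower than the normal component; the bound \<open>sqrt (b^2 - a^2)\<close> keeps
      the new scale \<open>sqrt (a^2 + v^2)\<close> at most \<open>b\<close>.\<close>
    define v where "v = min (\<sigma> / 2) (sqrt (b\<^sup>2 - a\<^sup>2))"
    have "a\<^sup>2 < b\<^sup>2" using assms by (simp add: power_strict_mono)
    then have v: "0 < v" "v < \<sigma>" using Q(1) by (auto simp: v_def)
    have "v\<^sup>2 \<le> (sqrt (b\<^sup>2 - a\<^sup>2))\<^sup>2" using v(1) by (intro power_mono) (auto simp: v_def)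
    then have "a\<^sup>2 + v\<^sup>2 \<le> b\<^sup>2" using \<open>a\<^sup>2 < b\<^sup>2\<close> by simp
    then have "sqrt (a\<^sup>2 + v\<^sup>2) \<le> b" using assms by (intro real_le_lsqrt) auto
    moreover have "a < sqrt (a\<^sup>2 + v\<^sup>2)" using v(1) by (intro real_less_rsqrt) simp
    moreover obtain p K where "0 \<le> p" "p \<le> 1" "K \<in> prob_distrs" "K \<in> NNorm"
      "\<And>y. p * (\<integral>x. Phi_kernel y x a \<partial>K) + (1 - p) * Phi_kernel y 0 (sqrt (a\<^sup>2 + v\<^sup>2)) = Fmix y Pbar"
      using split_off_atom_no_normal_component[OF Q(2) v assms(1)] M(2) unfolding Q(3) by metis
    ultimately show ?thesis by (intro conclude)
  qed
qed

end
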